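(* Let $G=(V,E)$ be a graph with edge weights $w\in\mathbb{R}^E_{\ge 0}$, let $f$ be its graph coverage function, and let $\mathcal{M}$ be a matroid on $V$ of rank $k\ge 1$. Let $\mathcal{P}$ be the partition returned by the Gomory-Hu tree algorithm run on the cut function $d_w$ and $\mathcal{M}$ (described in the context). Then $\mathcal{P}$ is feasible and $f(\mathcal{P})\le \tfrac{4}{3}\,\mathrm{OPT}$, where $\mathrm{OPT}$ is the minimum of $f(\mathcal{P}')$ over all feasible partitions $\mathcal{P}'$.
   Context: The graph coverage function is $f(S)=\sum_{uv\in E:\{u,v\}\cap S\ne\emptyset} w(uv)$ for $S\subseteq V$; the cut function is $d_w(S)=\sum_{uv\in E: |\{u,v\}\cap S|=1} w(uv)$ (symmetric and submodular). For a partition $\mathcal{P}$, $f(\mathcal{P})=\sum_{X\in\mathcal{P}}f(X)$. A partition $\{V_1,\dots,V_k\}$ of $V$ is feasible if some basis $B$ of $\mathcal{M}$ has $|B\cap V_i|=1$ for all $i$. A Gomory-Hu tree of a symmetric submodular $g$ on $V$ is a tree $H=(V,F)$ with weights $w_H\ge 0$ such that for all distinct $s,t$, the minimum $w_H$-weight on the $s$–$t$ path in $H$ equals $\min\{g(S): s\in S\subseteq V\setminus\{t\}\}$, and the two components of $H$ minus a minimum-weight edge of that path form a minimizer. For a tree $H=(V,F)$ and $\mathcal{M}=(V,\mathcal{I})$, let $\mathcal{I}'$ be the family of $X'\subseteq F$ such that the components $V_1,\dots,V_{|X'|+1}$ of $H-X'$ admit $v_i\in V_i$ with $\{v_1,\dots,v_{|X'|+1}\}\in\mathcal{I}$.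 Gomory-Hu tree algorithm on $(g,\mathcal{M})$: compute a Gomory-Hu tree $(H,w_H)$ of $g$; start with $C=\emptyset$; while $|C|<k-1$, add to $C$ an edge $e\notin C$ with $C\cup\{e\}\in\mathcal{I}'$ of minimum $w_H(e)$; return the components of $(V,F\setminus C)$. *)

theory Defs
  imports Complex_Main "HOL-Library.Disjoint_Sets"
begin

locale matroid =
  fixes V :: "'a set" and \<I> :: "'a set set"
  assumes finite_ground: "finite V"
    and indep_subset: "X \<in> \<I> \<Longrightarrow> X \<subseteq> V"
    and empty_indep: "{} \<in> \<I>"
    and indep_hereditary: "X \<in> \<I> \<Longrightarrow> Y \<subseteq> X \<Longrightarrow> Y \<in> \<I>"
    and indep_augment: "X \<in> \<I> \<Longrightarrow> Y \<in> \<I> \<Longrightarrow> card X < card Y \<Longrightarrow> \<exists>y\<in>Y - X. insert y X \<in> \<I>"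

definition basis :: "'a set set \<Rightarrow> 'a set \<Rightarrow> bool" where
  "basis \<I> B \<longleftrightarrow> B \<in> \<I> \<and> (\<forall>X\<in>\<I>. B \<subseteq> X \<longrightarrow> X = B)"

definition matroid_rank :: "'a set set \<Rightarrow> nat" where
  "matroid_rank \<I> = Max (card ` \<I>)"

text \<open>Graphs are finite, simple and undirected; an edge \<open>uv\<close> is the set \<open>{u, v}\<close>.\<close>

definition graph :: "'a set \<Rightarrow> 'a set set \<Rightarrow> bool" where
  "graph V E \<longleftrightarrow> finite V \<and> (\<forall>e\<in>E. e \<subseteq> V \<and> card e = 2)"

definition component :: "'a set \<Rightarrow> 'a set set \<Rightarrow> 'a \<Rightarrow> 'a set" where
  "component V E u = {v \<in> V. (u, v) \<in> {(x, y). {x, y} \<in> E}\<^sup>*}"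

definition components :: "'a set \<Rightarrow> 'a set set \<Rightarrow> 'a set set" where
  "components V E = component V E ` V"

fun path_edges :: "'a list \<Rightarrow> 'a set set" where
  "path_edges (x # y # xs) = insert {x, y} (path_edges (y # xs))"
| "path_edges _ = {}"

definition is_path :: "'a set \<Rightarrow> 'a set set \<Rightarrow> 'a \<Rightarrow> 'a list \<Rightarrow> 'a \<Rightarrow> bool" where
  "is_path V E s p t \<longleftrightarrow>
     p \<noteq> [] \<and> hd p = s \<and> last p = t \<and> distinct p \<and> set p \<subseteq> V \<and> path_edges p \<subseteq> E"

text \<open>A cycle is a path on at least three vertices whose end vertices are adjacent.\<close>

definition tree :: "'a set \<Rightarrow> 'a set set \<Rightarrow> bool" where
  "tree V F \<longleftrightarrow> graph V F \<and> V \<noteq> {} \<and>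
     (\<forall>s\<in>V. \<forall>t\<in>V. \<exists>p. is_path V F s p t) \<and>
     \<not> (\<exists>s p t. is_path V F s p t \<and> length p \<ge> 3 \<and> {t, s} \<in> F)"

definition coverage :: "'a set set \<Rightarrow> ('a set \<Rightarrow> real) \<Rightarrow> 'a set \<Rightarrow> real" where
  "coverage E w S = (\<Sum>e | e \<in> E \<and> e \<inter> S \<noteq> {}. w e)"

definition cut_fun :: "'a set set \<Rightarrow> ('a set \<Rightarrow> real) \<Rightarrow> 'a set \<Rightarrow> real" where
  "cut_fun E w S = (\<Sum>e | e \<in> E \<and> card (e \<inter> S) = 1. w e)"

definition partition_cost :: "('a set \<Rightarrow> real) \<Rightarrow> 'a set set \<Rightarrow> real" where
  "partition_cost f P = (\<Sum>X\<in>P. f X)"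

definition feasible :: "'a set \<Rightarrow> 'a set set \<Rightarrow> 'a set set \<Rightarrow> bool" where
  "feasible V \<I> P \<longleftrightarrow> partition_on V P \<and> card P = matroid_rank \<I> \<and>
     (\<exists>B. basis \<I> B \<and> (\<forall>X\<in>P. card (B \<inter> X) = 1))"

definition opt :: "'a set \<Rightarrow> 'a set set \<Rightarrow> ('a set \<Rightarrow> real) \<Rightarrow> real" where
  "opt V \<I> f = Min (partition_cost f ` {P. feasible V \<I> P})"

text \<open>In a tree the path \<open>p\<close> below is unique. Deleting an edge of it leaves two components,
  of which the one containing \<open>s\<close> is the candidate minimizer.\<close>

definition gomory_hu_tree ::
  "'a set \<Rightarrow> ('a set \<Rightarrow> real) \<Rightarrow> 'a set set \<Rightarrow> ('a set \<Rightarrow> real) \<Rightarrow> bool" where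
  "gomory_hu_tree V g F w\<^sub>H \<longleftrightarrow> tree V F \<and> (\<forall>e\<in>F. w\<^sub>H e \<ge> 0) \<and>
     (\<forall>s\<in>V. \<forall>t\<in>V. \<forall>p. s \<noteq> t \<longrightarrow> is_path V F s p t \<longrightarrow>
        Min (w\<^sub>H ` path_edges p) = Min (g ` {S. s \<in> S \<and> S \<subseteq> V - {t}}) \<and>
        (\<forall>e. is_arg_min w\<^sub>H (\<lambda>e. e \<in> path_edges p) e \<longrightarrow>
           is_arg_min g (\<lambda>S. s \<in> S \<and> S \<subseteq> V - {t}) (component V (F - {e}) s)))"

text \<open>The family \<open>\<I>'\<close>; the function \<open>v\<close> chooses one vertex in each component.\<close>

definition tree_indep :: "'a set \<Rightarrow> 'a set set \<Rightarrow> 'a set set \<Rightarrow> 'a set set set" where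
  "tree_indep V \<I> F = {X. X \<subseteq> F \<and>
     (\<exists>v. (\<forall>K\<in>components V (F - X). v K \<in> K) \<and> v ` components V (F - X) \<in> \<I>)}"

text \<open>One iteration of the while loop, with ties broken arbitrarily.\<close>

definition gh_step ::
  "'a set \<Rightarrow> 'a set set \<Rightarrow> 'a set set \<Rightarrow> ('a set \<Rightarrow> real) \<Rightarrow> 'a set set \<Rightarrow> 'a set set \<Rightarrow> bool" where
  "gh_step V \<I> F w\<^sub>H C C' \<longleftrightarrow> card C < matroid_rank \<I> - 1 \<and>
     (\<exists>e. is_arg_min w\<^sub>H (\<lambda>e. e \<in> F - C \<and> insert e C \<in> tree_indep V \<I> F) e \<and> C' = insert e C)"

text \<open>The possible results of the algorithm. A run ends when no further iteration is possible,
  so a hypothetical run that found no edge to add while \<open>|C| < k - 1\<close> is included as well, and a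
  statement about all results also covers the claim that this never happens.\<close>

definition gh_algorithm_returns ::
  "'a set \<Rightarrow> ('a set \<Rightarrow> real) \<Rightarrow> 'a set set \<Rightarrow> 'a set set \<Rightarrow> bool" where
  "gh_algorithm_returns V g \<I> P \<longleftrightarrow>
     (\<exists>F w\<^sub>H C. gomory_hu_tree V g F w\<^sub>H \<and> (gh_step V \<I> F w\<^sub>H)\<^sup>*\<^sup>* {} C \<and>
        \<not> (\<exists>C'. gh_step V \<I> F w\<^sub>H C C') \<and> P = components V (F - C))"

end

theory Submission
  imports Defs
begin

text \<open>Write \<open>W\<close> for the total weight and \<open>cr(\<P>)\<close> for the weight of the edges running between
  parts of \<open>\<P>\<close>, so that \<open>f(\<P>) = W + cr(\<P>)\<close>. The family \<open>\<I>'\<close> has the exchange property, hence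
  the greedy choice \<open>C\<close> has minimum tree weight among its members of size \<open>k - 1\<close>. Given a feasible
  partition \<open>\<Q>\<close> with transversal basis \<open>B\<close>, fix \<open>r \<in> B\<close> and choose for every other \<open>b \<in> B\<close> the
  first edge on the tree path from \<open>b\<close> to \<open>r\<close> leaving the part of \<open>b\<close>. These edges separate \<open>B\<close>,
  and each weighs at most the cut of the corresponding part, so that
  \<open>cr(\<P>) \<le> w\<^sub>H(C) \<le> 2 cr(\<Q>)\<close>. Together with \<open>cr(\<P>) \<le> W\<close> this gives
  \<open>3 f(\<P>) \<le> 3 W + 2 (2 cr(\<Q>)) + W = 4 f(\<Q>)\<close>.\<close>

section \<open>Connectivity\<close>

text \<open>The reachability relation underlying \<open>component\<close>, without the restriction
  to \<open>V\<close>; it is reflexive at every point, inside \<open>V\<close> or not.\<close>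

definition conn :: "'a set set \<Rightarrow> 'a \<Rightarrow> 'a \<Rightarrow> bool" where
  "conn A u v \<longleftrightarrow> (u, v) \<in> {(x, y). {x, y} \<in> A}\<^sup>*"

lemma component_conn: "component V A u = {v \<in> V. conn A u v}"
  by (simp add: component_def conn_def)

lemma conn_refl [simp]: "conn A u u"
  by (simp add: conn_def)

lemma conn_trans: "conn A u v \<Longrightarrow> conn A v x \<Longrightarrow> conn A u x"
  by (auto simp: conn_def intro: rtrancl_trans)

lemma conn_sym: "conn A u v \<Longrightarrow> conn A v u"
proof -
  have "sym {(x, y). {x, y} \<in> A}"
    by (auto simp: sym_def insert_commute)
  then show "conn A u v \<Longrightarrow> conn A v u"
    unfolding conn_def by (meson sym_rtrancl symD)
qed

lemma conn_mono: "conn A u v \<Longrightarrow> A \<subseteq> B \<Longrightarrow> conn B u v"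
  unfolding conn_def by (erule rtrancl_mono[THEN subsetD, rotated]) auto

lemma conn_edge: "{u, v} \<in> A \<Longrightarrow> conn A u v"
  by (auto simp: conn_def)

text \<open>A walk through the new edge can be shortened until it traverses that edge once. The edge
  contributes both orientations to the relation, so \<open>rtrancl_insert\<close> is applied twice
  and transitivity removes the surplus cases.\<close>

lemma conn_insert:
  "conn (insert {s, t} A) x y \<longleftrightarrow>
     conn A x y \<or> (conn A x s \<and> conn A t y) \<or> (conn A x t \<and> conn A s y)"
proof -
  have "{(x, y). {x, y} \<in> insert {s, t} A} = insert (s, t) (insert (t, s) {(x, y). {x, y} \<in> A})"
    by (auto simp: doubleton_eq_iff)
  then have "conn (insert {s, t} A) x y \<longleftrightarrow>
      (conn A x y \<or> conn A x t \<and> conn A s y) \<or>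
      (conn A x s \<or> conn A x t \<and> conn A s s) \<and> (conn A t y \<or> conn A t t \<and> conn A s y)"
    by (simp add: conn_def rtrancl_insert)
  then show ?thesis
    by (auto intro: conn_trans)
qed

lemma conn_Diff_edge:
  assumes "{s, t} \<in> A"
  shows "conn A x y \<longleftrightarrow> conn (A - {{s, t}}) x y \<or>
    (conn (A - {{s, t}}) x s \<and> conn (A - {{s, t}}) t y) \<or>
    (conn (A - {{s, t}}) x t \<and> conn (A - {{s, t}}) s y)"
  using conn_insert[of s t "A - {{s, t}}" x y] assms by (simp add: insert_absorb)

text \<open>A connection destroyed by deleting an edge must run through that edge, so the component
  of \<open>x\<close> contains both its ends.\<close>

lemma conn_lost_edge:
  assumes "{s, t} \<in> A" "conn A x y" "\<not> conn (A - {{s, t}}) x y"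
  shows "conn A x s"
proof -
  have "conn (A - {{s, t}}) x s \<or> conn (A - {{s, t}}) x t"
    using conn_Diff_edge[OF assms(1)] assms(2,3) by blast
  then show ?thesis
  proof
    assume "conn (A - {{s, t}}) x s"
    then show ?thesis by (rule conn_mono) blast
  next
    assume "conn (A - {{s, t}}) x t"
    then have "conn A x t" by (rule conn_mono) blast
    then show ?thesis using conn_sym[OF conn_edge[OF assms(1)]] by (rule conn_trans)
  qed
qed

lemma conn_closed:
  assumes "conn A u v" "u \<in> S" "\<And>x y. {x, y} \<in> A \<Longrightarrow> x \<in> S \<Longrightarrow> y \<in> S"
  shows "v \<in> S"
  using assms(1,2) unfolding conn_def
  by (induction rule: rtrancl_induct) (auto intro: assms(3))

lemma path_edges_append: "path_edges ys \<subseteq> path_edges (xs @ ys)"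
proof (induction xs)
  case (Cons x xs)
  then show ?case by (cases "xs @ ys") auto
qed simp

lemma conn_of_path:
  assumes "is_path V A s p t"
  shows "conn A s t"
proof -
  have "p \<noteq> [] \<Longrightarrow> path_edges p \<subseteq> A \<Longrightarrow> conn A (hd p) (last p)"
  proof (induction p rule: path_edges.induct)
    case (1 x y xs)
    then show ?case using conn_trans[OF conn_edge[of x y A]] by auto
  qed auto
  then show ?thesis using assms by (auto simp: is_path_def)
qed

text \<open>The path is built backwards from its end \<open>v\<close>. If the vertex to be prepended
  already occurs, the suffix starting at it is a path.\<close>

lemma path_of_conn:
  assumes "conn A u v" "v \<in> V" "\<Union>A \<subseteq> V"
  shows "\<exists>p. is_path V A u p v"
  using assms(1) unfolding conn_def
proof (induction rule: converse_rtrancl_induct)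
  case base
  have "is_path V A v [v] v" using assms(2) by (auto simp: is_path_def)
  then show ?case by blast
next
  case (step x y)
  then obtain p where p: "is_path V A y p v" by blast
  show ?case
  proof (cases "x \<in> set p")
    case True
    then obtain xs ys where ys: "p = xs @ x # ys" by (auto simp: in_set_conv_decomp)
    have "path_edges (x # ys) \<subseteq> path_edges p"
      unfolding ys by (rule path_edges_append)
    then have "is_path V A x (x # ys) v" using p by (auto simp: is_path_def ys)
    then show ?thesis by blast
  next
    case False
    have "path_edges (x # p) \<subseteq> A"
      using p step(1) by (cases p) (auto simp: is_path_def)
    moreover have "x \<in> V" using step(1) assms(3) by auto
    ultimately have "is_path V A x (x # p) v" using p False by (auto simp: is_path_def)
    then show ?thesis by blast
  qed
qed

lemma conn_cong: "conn A u v \<Longrightarrow> conn A u x \<longleftrightarrow> conn A v x"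
  using conn_trans conn_sym by metis

section \<open>Components as a partition of the vertex set\<close>

lemma component_eq_iff:
  assumes "u \<in> V" "v \<in> V"
  shows "component V A u = component V A v \<longleftrightarrow> conn A u v"
proof
  assume "component V A u = component V A v"
  then have "v \<in> component V A u" using assms by (simp add: component_conn)
  then show "conn A u v" by (simp add: component_conn)
next
  assume "conn A u v"
  from conn_cong[OF this] show "component V A u = component V A v" by (simp add: component_conn)
qed

lemma components_partition_on: "partition_on V (components V A)"
proof (rule partition_onI)
  show "\<Union>(components V A) = V"
    by (auto simp: components_def component_conn)
next
  fix K L assume "K \<in> components V A" "L \<in> components V A" "K \<noteq> L"
  then obtain u v where uv: "u \<in> V" "v \<in> V" "K = component V A u" "L = component V A v"
    by (auto simp: components_def)
  then have "\<not> conn A u v" using \<open>K \<noteq> L\<close> by (simp add: component_eq_iff)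
  then have "conn A u x \<Longrightarrow> conn A v x \<Longrightarrow> False" for x
    using conn_trans conn_sym by metis
  then show "disjnt K L"
    using uv by (auto simp: disjnt_def component_conn)
next
  show "{} \<notin> components V A"
    by (auto simp: components_def component_conn)
qed

text \<open>The new edge merges the classes of \<open>s\<close> and \<open>t\<close> and leaves
  every other class unchanged.\<close>

lemma card_components_insert:
  assumes "finite V" "s \<in> V" "t \<in> V" "\<not> conn A s t"
  shows "card (components V A) = Suc (card (components V (insert {s, t} A)))"
proof -
  let ?c = "component V A"
  let ?rest = "components V A - {?c s, ?c t}"
  have comp: "component V (insert {s, t} A) u =
      (if conn A u s \<or> conn A u t then ?c s \<union> ?c t else ?c u)" if "u \<in> V" for u
  proof -
    have ts: "\<not> conn A t s" using assms(4) conn_sym by metis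
    consider "conn A u s" | "conn A u t" | "\<not> conn A u s" "\<not> conn A u t" by blast
    then show ?thesis
    proof cases
      case 1
      then show ?thesis
        using assms(4) by (auto simp: component_conn conn_insert conn_cong[OF 1])
    next
      case 2
      then show ?thesis
        using ts by (auto simp: component_conn conn_insert conn_cong[OF 2])
    qed (auto simp: component_conn conn_insert)
  qed
  have eq: "components V (insert {s, t} A) = insert (?c s \<union> ?c t) ?rest"
  proof
    show "components V (insert {s, t} A) \<subseteq> insert (?c s \<union> ?c t) ?rest"
    proof
      fix K assume "K \<in> components V (insert {s, t} A)"
      then obtain u where u: "u \<in> V" "K = component V (insert {s, t} A) u"
        by (auto simp: components_def)
      have "?c u \<in> components V A" using u(1) by (simp add: components_def)
      then show "K \<in> insert (?c s \<union> ?c t) ?rest"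
        using comp[OF u(1)] u assms(2,3) component_eq_iff[of u V _ A] by simp
    qed
    have "component V (insert {s, t} A) s = ?c s \<union> ?c t"
      using comp assms(2) by auto
    then have "?c s \<union> ?c t \<in> components V (insert {s, t} A)"
      using assms(2) unfolding components_def by blast
    moreover have "?rest \<subseteq> components V (insert {s, t} A)"
    proof
      fix K assume "K \<in> ?rest"
      then obtain u where "u \<in> V" "K = ?c u" "?c u \<noteq> ?c s" "?c u \<noteq> ?c t"
        by (auto simp: components_def)
      then have "K = component V (insert {s, t} A) u"
        using comp assms(2,3) by (simp add: component_eq_iff)
      then show "K \<in> components V (insert {s, t} A)"
        using \<open>u \<in> V\<close> by (auto simp: components_def)
    qed
    ultimately show "insert (?c s \<union> ?c t) ?rest \<subseteq> components V (insert {s, t} A)" by blast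
  qed
  \<comment> \<open>Needed for the count: the merged class must not coincide with a class that was
    kept.\<close>
  have new: "?c s \<union> ?c t \<notin> ?rest"
  proof
    assume "?c s \<union> ?c t \<in> ?rest"
    then obtain u where "u \<in> V" "?c u = ?c s \<union> ?c t" by (auto simp: components_def)
    moreover have "s \<in> ?c s \<union> ?c t" "t \<in> ?c s \<union> ?c t"
      using assms(2,3) by (simp_all add: component_conn)
    ultimately have "s \<in> ?c u" "t \<in> ?c u" by simp_all
    then have "conn A u s" "conn A u t" by (simp_all add: component_conn)
    then show False using assms(4) conn_trans conn_sym by metis
  qed
  have fin: "finite (components V A)" using assms(1) by (simp add: components_def)
  have sub: "{?c s, ?c t} \<subseteq> components V A"
    using assms(2,3) by (auto simp: components_def)
  have "card {?c s, ?c t} = 2" using assms by (simp add: component_eq_iff)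
  then have "card (components V A) = Suc (Suc (card ?rest))"
    using card_Diff_subset[of "{?c s, ?c t}" "components V A"] card_mono[OF fin sub] sub by simp
  then show ?thesis using eq new fin by simp
qed

section \<open>Deleting edges from a tree\<close>

locale tree_graph =
  fixes V :: "'a set" and F :: "'a set set"
  assumes tree: "tree V F"
begin

lemma finite_V: "finite V"
  using tree by (simp add: tree_def graph_def)

lemma edge_in_V: "e \<in> F \<Longrightarrow> e \<subseteq> V"
  using tree by (simp add: tree_def graph_def)

lemma finite_F: "finite F"
  using edge_in_V finite_V by (meson Pow_iff finite_Pow_iff finite_subset subsetI)

lemma edgeE:
  assumes "e \<in> F"
  obtains s t where "e = {s, t}" "s \<noteq> t" "s \<in> V" "t \<in> V"
  proof -
  have "card e = 2" using assms tree by (simp add: tree_def graph_def)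
  then show thesis using that edge_in_V[OF assms] by (auto simp: card_2_iff)
qed

lemma conn_tree: "u \<in> V \<Longrightarrow> v \<in> V \<Longrightarrow> conn F u v"
  using tree conn_of_path unfolding tree_def by metis

text \<open>A path joining the ends without the edge would close to a cycle with it. Such a path has
  at least three vertices, because a single vertex would give \<open>s = t\<close> and two vertices
  would use the deleted edge.\<close>

lemma edge_is_bridge:
  assumes "{s, t} \<in> F"
  shows "\<not> conn (F - {{s, t}}) s t"
proof
  assume c: "conn (F - {{s, t}}) s t"
  have st: "s \<noteq> t" "t \<in> V" using edgeE[OF assms] by (metis doubleton_eq_iff)+
  obtain p where p: "is_path V (F - {{s, t}}) s p t"
    using path_of_conn[OF c st(2)] edge_in_V by blast
  have "length p \<ge> 3"
  proof (rule ccontr)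
    assume "\<not> length p \<ge> 3"
    moreover obtain x q where "p = x # q" using p by (cases p) (auto simp: is_path_def)
    moreover obtain y q' where "q = y # q'"
      using p st(1) calculation by (cases q) (auto simp: is_path_def)
    ultimately show False using p by (cases q') (auto simp: is_path_def)
  qed
  moreover have "is_path V F s p t" using p by (auto simp: is_path_def)
  moreover have "{t, s} \<in> F" using assms by (simp add: insert_commute)
  ultimately show False using tree unfolding tree_def by blast
qed

text \<open>Deleting \<open>e\<close> leaves every vertex connected to an end of \<open>e\<close>,
  so there are at most two sides; two vertices both separated from \<open>v\<close> are on the same
  one.\<close>

lemma bridge_two_sides:
  assumes "e \<in> F" "u \<in> V" "v \<in> V" "x \<in> V"
    "\<not> conn (F - {e}) u v" "\<not> conn (F - {e}) v x"
  shows "conn (F - {e}) u x"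
proof -
  obtain s t where e: "e = {s, t}" using edgeE[OF assms(1)] by metis
  have "conn (F - {e}) y s \<or> conn (F - {e}) y t" if "y \<in> V" for y
    using conn_Diff_edge[of s t F y s] conn_tree[OF that, of s] assms(1) e edge_in_V
    by auto
  then show ?thesis using assms conn_trans[of "F - {e}"] conn_sym[of "F - {e}"] by metis
qed

text \<open>Every edge being a bridge, deletions do not interact. This reduces the later separation
  arguments to single edges.\<close>

lemma conn_Diff_iff:
  assumes "C \<subseteq> F" "u \<in> V" "v \<in> V"
  shows "conn (F - C) u v \<longleftrightarrow> (\<forall>e\<in>C. conn (F - {e}) u v)"
proof
  show "conn (F - C) u v \<Longrightarrow> \<forall>e\<in>C. conn (F - {e}) u v"
    by (auto intro: conn_mono)
next
  have "finite C" using assms(1) finite_F finite_subset by blast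
  then show "\<forall>e\<in>C. conn (F - {e}) u v \<Longrightarrow> conn (F - C) u v"
    using assms(1)
  proof (induction C rule: finite_induct)
    case empty
    then show ?case using conn_tree assms by simp
  next
    case (insert e C)
    obtain s t where e: "e = {s, t}" using insert.prems(2) edgeE[of e] by blast
    have C: "conn (F - C) u v" using insert by simp
    have eq: "F - C - {{s, t}} = F - insert e C" using e by blast
    have mono: "conn (F - insert e C) x y \<Longrightarrow> conn (F - {e}) x y" for x y
      by (erule conn_mono) blast
    have "{s, t} \<in> F - C" using insert e by blast
    from conn_Diff_edge[OF this, of u v] C
    consider "conn (F - insert e C) u v"
      | "conn (F - {e}) u s" "conn (F - {e}) t v" | "conn (F - {e}) u t" "conn (F - {e}) s v"
      unfolding eq using mono by blast
    then show ?case
    proof cases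
      case 1
      then show ?thesis .
    next
      \<comment> \<open>Here and in the next case, the two pieces and the connection of
        \<open>u\<close> to \<open>v\<close> in \<open>F - {e}\<close> would join the ends of
        \<open>e\<close> without \<open>e\<close>.\<close>
      case 2
      then have "conn (F - {e}) s t"
        using insert.prems(1) conn_trans[of "F - {e}"] conn_sym[of "F - {e}"] by (metis insertI1)
      then show ?thesis using edge_is_bridge[of s t] insert.prems(2) e by auto
    next
      case 3
      then have "conn (F - {e}) s t"
        using insert.prems(1) conn_trans[of "F - {e}"] conn_sym[of "F - {e}"] by (metis insertI1)
      then show ?thesis using edge_is_bridge[of s t] insert.prems(2) e by auto
    qed
  qed
qed

text \<open>Each deleted edge is a bridge and hence splits one component in two, starting from the
  single component of the tree.\<close>

lemma card_components_Diff:
  assumes "X \<subseteq> F"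
  shows "card (components V (F - X)) = Suc (card X)"
proof -
  have "finite X" using assms finite_F finite_subset by blast
  then show ?thesis using assms
  proof (induction X rule: finite_induct)
    case empty
    have "component V F u = V" if "u \<in> V" for u
      using conn_tree that by (auto simp: component_conn)
    then have "components V F = {V}" using tree by (auto simp: components_def tree_def)
    then show ?case by simp
  next
    case (insert e X)
    obtain s t where e: "e = {s, t}" "s \<in> V" "t \<in> V" using insert.prems edgeE[of e] by blast
    have "\<not> conn (F - insert e X) s t"
      using edge_is_bridge[of s t] insert.prems e(1) conn_mono[of "F - insert e X" s t "F - {e}"]
      by auto
    moreover have "insert {s, t} (F - insert e X) = F - X" using insert e(1) by blast
    ultimately show ?case
      using card_components_insert[OF finite_V e(2,3), of "F - insert e X"] insert by simp
  qed
qed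

text \<open>A system of representatives for the components, described by \<open>conn\<close> rather
  than by the choice function in \<open>tree_indep\<close>.\<close>

definition transversal :: "'a set set \<Rightarrow> 'a set \<Rightarrow> bool" where
  "transversal A I \<longleftrightarrow> I \<subseteq> V \<and> (\<forall>u\<in>V. \<exists>i\<in>I. conn A u i) \<and> (\<forall>i\<in>I. \<forall>j\<in>I. conn A i j \<longrightarrow> i = j)"

lemma transversal_bij_betw:
  assumes "transversal A I"
  shows "bij_betw (component V A) I (components V A)"
proof -
  have "inj_on (component V A) I"
    using assms by (auto simp: inj_on_def transversal_def component_eq_iff subset_iff)
  moreover have "component V A ` I = components V A"
    using assms by (fastforce simp: components_def transversal_def component_eq_iff subset_iff image_iff)
  ultimately show ?thesis by (simp add: bij_betw_def)
qed

lemma card_transversal: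
  assumes "transversal (F - X) I" "X \<subseteq> F"
  shows "card I = Suc (card X)"
  using transversal_bij_betw[OF assms(1)] card_components_Diff[OF assms(2)]
  by (simp add: bij_betw_same_card)

lemma transversal_Int_component:
  assumes "transversal A I" "K \<in> components V A"
  shows "card (I \<inter> K) = 1"
proof -
  obtain u where u: "u \<in> V" "K = component V A u" using assms(2) by (auto simp: components_def)
  obtain i where "i \<in> I" "conn A u i" using assms(1) u by (auto simp: transversal_def)
  then have "I \<inter> K = {i}"
    using assms(1) u conn_trans[of A] conn_sym[of A] unfolding transversal_def component_conn by blast
  then show ?thesis by simp
qed

text \<open>The edge is the first one on the path from \<open>b\<close> to \<open>r\<close> that leaves the class of \<open>b\<close>.\<close>

lemma exists_class_leaving_edge:
  assumes "b \<in> V" "r \<in> V" "h r \<noteq> h b"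
  obtains s t where "{s, t} \<in> F" "h s = h b" "h t \<noteq> h b"
    "conn {e \<in> F. \<forall>x\<in>e. h x = h b} b s" "\<not> conn (F - {{s, t}}) b r" "s \<in> V" "t \<in> V"
proof -
  let ?A = "{e \<in> F. \<forall>x\<in>e. h x = h b}"
  \<comment> \<open>\<open>?C\<close> collects the edges leaving the set reachable from
    \<open>b\<close> inside its class. Deleting all of them cuts \<open>b\<close> off from
    \<open>r\<close>, so by \<open>conn_Diff_iff\<close> a single one of them does.\<close>
  let ?C = "{e \<in> F. \<exists>s t. e = {s, t} \<and> conn ?A b s \<and> \<not> conn ?A b t}"
  have hK: "h s = h b" if "conn ?A b s" for s
    using conn_closed[OF that, of "{s. h s = h b}"] by auto
  have "\<not> conn (F - ?C) b r"
  proof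
    assume "conn (F - ?C) b r"
    then have "r \<in> {s. conn ?A b s}"
    proof (rule conn_closed)
      fix x y assume "{x, y} \<in> F - ?C" "x \<in> {s. conn ?A b s}"
      then show "y \<in> {s. conn ?A b s}" by blast
    qed simp
    then show False using hK[of r] assms(3) by blast
  qed
  then obtain e where e: "e \<in> ?C" "\<not> conn (F - {e}) b r"
    using conn_Diff_iff[of ?C b r] assms(1,2) by blast
  then obtain s t where st: "e = {s, t}" "conn ?A b s" "\<not> conn ?A b t" "{s, t} \<in> F" by blast
  have "h t \<noteq> h b"
  proof
    assume "h t = h b"
    then have "conn ?A s t" using st(4) hK[OF st(2)] by (intro conn_edge) simp
    then show False using st(3) conn_trans[OF st(2)] by blast
  qed
  moreover have "s \<in> V" "t \<in> V" using edge_in_V[OF st(4)] by auto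
  ultimately show thesis using that[OF st(4) hK[OF st(2)] _ st(2) e(2)[unfolded st(1)]] by blast
qed

text \<open>Rooting the tree at \<open>r\<close>, an edge is chosen only for the class of its lower end, so the edges
  are distinct. If \<open>x\<close> is the lowest common ancestor of \<open>b\<close> and \<open>c\<close>, then \<open>x\<close> misses the class of
  one of them, and the edge chosen for that one lies below \<open>x\<close>.\<close>

lemma exists_separating_edges:
  assumes B: "B \<subseteq> V" "r \<in> B" and h: "\<And>b. b \<in> B \<Longrightarrow> h b = b"
  obtains \<epsilon> where "inj_on \<epsilon> (B - {r})" "\<epsilon> ` (B - {r}) \<subseteq> F"
    "\<And>b. b \<in> B - {r} \<Longrightarrow> \<exists>s t. \<epsilon> b = {s, t} \<and> h s = b \<and> h t \<noteq> b"
    "transversal (F - \<epsilon> ` (B - {r})) B"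
proof -
  let ?A = "\<lambda>b. {e \<in> F. \<forall>x\<in>e. h x = b}"
  \<comment> \<open>In \<open>Q b s t\<close> the edge is oriented: \<open>s\<close> is the end in
    the class of \<open>b\<close>, and \<open>t\<close> the end towards \<open>r\<close>.\<close>
  define Q where "Q b s t \<longleftrightarrow> {s, t} \<in> F \<and> h s = b \<and> h t \<noteq> b \<and> conn (?A b) b s \<and>
      \<not> conn (F - {{s, t}}) b r \<and> s \<in> V \<and> t \<in> V" for b s t
  have "\<exists>s t. Q b s t" if b: "b \<in> B - {r}" for b
  proof -
    have "b \<in> V" "r \<in> V" "h r \<noteq> h b" "h b = b" using B h b by auto
    from exists_class_leaving_edge[OF this(1-3)] show ?thesis
      unfolding \<open>h b = b\<close> Q_def by blast
  qed
  then obtain \<sigma> \<tau> where "\<And>b. b \<in> B - {r} \<Longrightarrow> Q b (\<sigma> b) (\<tau> b)"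
    by metis
  note st = this[unfolded Q_def]
  define \<epsilon> where "\<epsilon> b = {\<sigma> b, \<tau> b}" for b
  have inF: "\<epsilon> b \<in> F" and br: "\<not> conn (F - {\<epsilon> b}) b r" if "b \<in> B - {r}" for b
    using st[OF that] by (auto simp: \<epsilon>_def)
  \<comment> \<open>A chosen edge has ends with different labels, so deleting it leaves all
    connections inside a single class intact.\<close>
  have inA: "conn (F - {\<epsilon> c}) b (\<sigma> b)" if "b \<in> B - {r}" "c \<in> B - {r}" for b c
  proof (rule conn_mono)
    show "conn (?A b) b (\<sigma> b)" using st[OF that(1)] by blast
    have "\<epsilon> c \<notin> ?A b" using st[OF that(2)] by (auto simp: \<epsilon>_def)
    then show "?A b \<subseteq> F - {\<epsilon> c}" by auto
  qed
  have bridge: "\<not> conn (F - {\<epsilon> b}) (\<sigma> b) (\<tau> b)" if "b \<in> B - {r}" for b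
    using edge_is_bridge[of "\<sigma> b" "\<tau> b"] st[OF that] by (simp add: \<epsilon>_def)
  \<comment> \<open>\<open>\<sigma> b\<close> lies on the side of \<open>b\<close>, away from
    \<open>r\<close>, so the other end lies on the side of \<open>r\<close>.\<close>
  have tr: "conn (F - {\<epsilon> b}) (\<tau> b) r" if b: "b \<in> B - {r}" for b
  proof (rule bridge_two_sides[OF inF[OF b], of _ "\<sigma> b"])
    show "\<tau> b \<in> V" "\<sigma> b \<in> V" "r \<in> V" using st[OF b] B by auto
    show "\<not> conn (F - {\<epsilon> b}) (\<tau> b) (\<sigma> b)" using bridge[OF b] conn_sym by metis
    show "\<not> conn (F - {\<epsilon> b}) (\<sigma> b) r" using br[OF b] inA[OF b b] conn_trans by metis
  qed
  have inj: "inj_on \<epsilon> (B - {r})"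
  proof (rule inj_onI, rule ccontr)
    fix b c assume bc: "b \<in> B - {r}" "c \<in> B - {r}" "\<epsilon> b = \<epsilon> c" "b \<noteq> c"
    \<comment> \<open>If two labels shared an edge, it would be oriented both ways, and both its
      ends would lie on the side of \<open>r\<close>.\<close>
    then have "\<sigma> b \<noteq> \<sigma> c" using st by metis
    then have "\<tau> c = \<sigma> b" using bc(3) by (auto simp: \<epsilon>_def doubleton_eq_iff)
    then show False
      using tr[OF bc(1)] tr[OF bc(2)] bridge[OF bc(1)] bc(3) conn_trans conn_sym by metis
  qed
  let ?C = "\<epsilon> ` (B - {r})"
  have C: "?C \<subseteq> F" using inF by blast
  have sep: "\<not> conn (F - ?C) b c" if bc: "b \<in> B - {r}" "c \<in> B - {r}" "b \<noteq> c" for b c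
  proof
    assume conn: "conn (F - ?C) b c"
    have bcV: "b \<in> V" "c \<in> V" using bc B by auto
    have bcb: "conn (F - {\<epsilon> b}) b c" and bcc: "conn (F - {\<epsilon> c}) b c"
      using conn conn_Diff_iff[OF C bcV] bc by auto
    have ne: "\<epsilon> b \<noteq> \<epsilon> c" using inj bc by (auto dest: inj_onD)
    let ?D = "F - {\<epsilon> b} - {\<epsilon> c}"
    have in1: "conn (F - {\<epsilon> b}) x y" and in2: "conn (F - {\<epsilon> c}) x y" if "conn ?D x y" for x y
      using that by (auto elim: conn_mono)
    \<comment> \<open>If \<open>b\<close> and \<open>c\<close> stay together, deleting either chosen
      edge cuts both of them off from \<open>r\<close>. The facts \<open>s1\<close> to
      \<open>s3\<close> transfer this to ends of the chosen edges.\<close>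
    have s1: "\<not> conn (F - {\<epsilon> b}) (\<sigma> c) r"
      using br[OF bc(1)] bcb inA[OF bc(2,1)] conn_trans[of "F - {\<epsilon> b}"] by metis
    have s2: "\<not> conn (F - {\<epsilon> b}) (\<tau> c) r"
    proof
      have "conn (F - {\<epsilon> b}) (\<sigma> c) (\<tau> c)"
        using st[OF bc(2)] ne by (intro conn_edge) (auto simp: \<epsilon>_def)
      moreover assume "conn (F - {\<epsilon> b}) (\<tau> c) r"
      ultimately show False using s1 conn_trans by metis
    qed
    have s3: "\<not> conn (F - {\<epsilon> c}) (\<tau> b) r"
    proof
      have "conn (F - {\<epsilon> c}) (\<sigma> b) (\<tau> b)"
        using st[OF bc(1)] ne by (intro conn_edge) (auto simp: \<epsilon>_def)
      moreover assume "conn (F - {\<epsilon> c}) (\<tau> b) r"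
      ultimately have "conn (F - {\<epsilon> c}) b r"
        using inA[OF bc(1,2)] conn_trans[of "F - {\<epsilon> c}"] by metis
      then show False using br[OF bc(2)] bcc conn_trans[of "F - {\<epsilon> c}"] conn_sym by metis
    qed
    \<comment> \<open>The connection from \<open>\<tau> b\<close> to \<open>r\<close> avoiding
      \<open>\<epsilon> b\<close> either avoids \<open>\<epsilon> c\<close> too, against
      \<open>s3\<close>, or passes through it, against \<open>s1\<close> or
      \<open>s2\<close>.\<close>
    have "{\<sigma> c, \<tau> c} \<in> F - {\<epsilon> b}" using st[OF bc(2)] ne by (auto simp: \<epsilon>_def)
    from conn_Diff_edge[OF this, of "\<tau> b" r] tr[OF bc(1)]
    have "conn ?D (\<tau> b) r \<or> conn ?D (\<tau> c) r \<or> conn ?D (\<sigma> c) r"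
      unfolding \<epsilon>_def by blast
    then show False using s1 s2 s3 in1 in2 by blast
  qed
  have sep_root: "\<not> conn (F - ?C) b r" if "b \<in> B - {r}" for b
    using br[OF that] conn_Diff_iff[OF C, of b r] that B by blast
  have sepB: "\<not> conn (F - ?C) b c" if "b \<in> B" "c \<in> B" "b \<noteq> c" for b c
    using sep[of b c] sep_root[of b] sep_root[of c] conn_sym[of "F - ?C" b c] that by blast
  \<comment> \<open>Covering follows by counting: \<open>B\<close> injects into the components, and
    there are \<open>card B\<close> of them.\<close>
  have onto: "component V (F - ?C) ` B = components V (F - ?C)"
  proof (rule card_seteq)
    have finB: "finite B" using B finite_V finite_subset by blast
    show "finite (components V (F - ?C))" using finite_V by (simp add: components_def)
    show "component V (F - ?C) ` B \<subseteq> components V (F - ?C)" using B by (auto simp: components_def)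
    have "inj_on (component V (F - ?C)) B"
      using sepB B by (auto simp: inj_on_def component_eq_iff subset_iff)
    then have "card (component V (F - ?C) ` B) = card B" by (rule card_image)
    also have "\<dots> = Suc (card (B - {r}))"
      using finB B(2) by (metis card.remove)
    also have "\<dots> = card (components V (F - ?C))"
      using card_components_Diff[OF C] card_image[OF inj] by simp
    finally show "card (components V (F - ?C)) \<le> card (component V (F - ?C) ` B)" by simp
  qed
  have "\<exists>b\<in>B. conn (F - ?C) u b" if u: "u \<in> V" for u
  proof -
    have "component V (F - ?C) u \<in> component V (F - ?C) ` B"
      using onto u by (simp add: components_def)
    then obtain b where b: "b \<in> B" "component V (F - ?C) u = component V (F - ?C) b" by blast
    then have "b \<in> V" using B by blast
    then show ?thesis using b component_eq_iff[OF u] by blast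
  qed
  then have "transversal (F - ?C) B"
    using sepB B by (auto simp: transversal_def)
  moreover have "\<exists>s t. \<epsilon> b = {s, t} \<and> h s = b \<and> h t \<noteq> b" if "b \<in> B - {r}" for b
    using st[OF that] unfolding \<epsilon>_def by blast
  ultimately show thesis using that[OF inj C] by blast
qed

end

section \<open>The matroid of independent edge deletions\<close>

locale tree_matroid = tree_graph V F + matroid V \<I>
  for V :: "'a set" and F :: "'a set set" and \<I> :: "'a set set"
begin

lemma finite_indep: "finite \<I>"
  using finite_V indep_subset by (meson Pow_iff finite_Pow_iff finite_subset subsetI)

lemma finite_indep_set: "I \<in> \<I> \<Longrightarrow> finite I"
  using finite_V indep_subset finite_subset by metis

lemma card_indep_le_rank: "I \<in> \<I> \<Longrightarrow> card I \<le> matroid_rank \<I>"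
  unfolding matroid_rank_def using finite_indep by simp

lemma exists_indep_card_rank: "\<exists>I\<in>\<I>. card I = matroid_rank \<I>"
proof -
  have "Max (card ` \<I>) \<in> card ` \<I>"
    using finite_indep empty_indep by (intro Max_in) auto
  then show ?thesis by (auto simp: matroid_rank_def)
qed

lemma basis_iff_card: "basis \<I> B \<longleftrightarrow> B \<in> \<I> \<and> card B = matroid_rank \<I>"
proof
  assume B: "basis \<I> B"
  then have "B \<in> \<I>" by (simp add: basis_def)
  moreover have "\<not> card B < matroid_rank \<I>"
  proof
    assume "card B < matroid_rank \<I>"
    then obtain y where "y \<notin> B" "insert y B \<in> \<I>"
      using exists_indep_card_rank indep_augment[OF \<open>B \<in> \<I>\<close>] by fastforce
    then show False using B unfolding basis_def by blast
  qed
  ultimately show "B \<in> \<I> \<and> card B = matroid_rank \<I>"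
    using card_indep_le_rank le_neq_implies_less by blast
next
  assume B: "B \<in> \<I> \<and> card B = matroid_rank \<I>"
  have "X = B" if "X \<in> \<I>" "B \<subseteq> X" for X
    using card_seteq[of X B] B that finite_indep_set card_indep_le_rank by auto
  then show "basis \<I> B" using B by (simp add: basis_def)
qed

text \<open>Picking one element of \<open>I\<close> per component gives a subset of
  \<open>I\<close>, which is independent by heredity; so \<open>I\<close> may meet a component
  several times.\<close>

lemma tree_indepI:
  assumes "X \<subseteq> F" "I \<in> \<I>" "\<And>u. u \<in> V \<Longrightarrow> \<exists>i\<in>I. conn (F - X) u i"
  shows "X \<in> tree_indep V \<I> F"
proof -
  let ?v = "\<lambda>K. SOME i. i \<in> I \<inter> K"
  have v: "?v K \<in> I \<inter> K" if K: "K \<in> components V (F - X)" for K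
  proof -
    obtain u where u: "u \<in> V" "K = component V (F - X) u" using K by (auto simp: components_def)
    obtain i where "i \<in> I" "conn (F - X) u i" using assms(3) u by blast
    then have "i \<in> I \<inter> K" using u indep_subset[OF assms(2)] by (auto simp: component_conn)
    then show ?thesis by (rule someI)
  qed
  then have "?v ` components V (F - X) \<subseteq> I" by blast
  then have "?v ` components V (F - X) \<in> \<I>" using indep_hereditary assms(2) by blast
  moreover have "\<forall>K\<in>components V (F - X). ?v K \<in> K" using v by blast
  ultimately show ?thesis
    using assms(1) unfolding tree_indep_def by (intro CollectI conjI exI[of _ ?v])
qed

lemma tree_indepE:
  assumes "X \<in> tree_indep V \<I> F"
  obtains I where "X \<subseteq> F" "I \<in> \<I>" "transversal (F - X) I"
proof -
  let ?c = "component V (F - X)"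
  obtain v where X: "X \<subseteq> F" and v: "\<And>K. K \<in> components V (F - X) \<Longrightarrow> v K \<in> K"
    and I: "v ` components V (F - X) \<in> \<I>"
    using assms by (auto simp: tree_indep_def)
  have vc: "conn (F - X) u (v (?c u))" if "u \<in> V" for u
    using v[of "?c u"] that by (auto simp: components_def component_conn)
  have "transversal (F - X) (v ` components V (F - X))"
    unfolding transversal_def
  proof (intro conjI ballI impI)
    show "v ` components V (F - X) \<subseteq> V" using indep_subset[OF I] .
    show "\<exists>i\<in>v ` components V (F - X). conn (F - X) u i" if "u \<in> V" for u
      using vc[OF that] that by (auto simp: components_def)
    fix i j assume i: "i \<in> v ` components V (F - X)" and j: "j \<in> v ` components V (F - X)"
      and c: "conn (F - X) i j"
    obtain a b where ab: "a \<in> V" "b \<in> V" "i = v (?c a)" "j = v (?c b)"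
      using i j by (auto simp: components_def)
    then have "conn (F - X) a b" using vc[of a] vc[of b] c conn_trans conn_sym by metis
    then show "i = j" using ab component_eq_iff by metis
  qed
  then show thesis using that X I by blast
qed

text \<open>Deleting fewer edges only merges components, so a set meeting all of the finer ones
  meets all of the coarser ones.\<close>

lemma tree_indep_hereditary:
  assumes "Y \<in> tree_indep V \<I> F" "X \<subseteq> Y"
  shows "X \<in> tree_indep V \<I> F"
proof -
  obtain I where I: "Y \<subseteq> F" "I \<in> \<I>" "transversal (F - Y) I" using assms(1) by (rule tree_indepE)
  have "\<exists>i\<in>I. conn (F - X) u i" if "u \<in> V" for u
  proof -
    obtain i where "i \<in> I" "conn (F - Y) u i" using I(3) \<open>u \<in> V\<close> by (auto simp: transversal_def)
    moreover have "F - Y \<subseteq> F - X" using assms(2) by blast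
    ultimately show ?thesis using conn_mono by metis
  qed
  moreover have "X \<subseteq> F" using I(1) assms(2) by blast
  ultimately show ?thesis using tree_indepI I(2) by blast
qed

text \<open>Among the independent transversals \<open>I\<close> for \<open>X\<close>, take one with the largest overlap with a
  transversal \<open>J\<close> for \<open>Y\<close>. If \<open>z \<in> J\<close> augments \<open>I\<close> and \<open>u \<in> I\<close> lies in the component of \<open>z\<close>,
  then \<open>Y\<close> separates \<open>z\<close> from \<open>u\<close>, since otherwise exchanging \<open>u\<close> for \<open>z\<close> increases the overlap.\<close>

lemma tree_indep_augment:
  assumes X: "X \<in> tree_indep V \<I> F" and Y: "Y \<in> tree_indep V \<I> F" and less: "card X < card Y"
  shows "\<exists>y\<in>Y - X. insert y X \<in> tree_indep V \<I> F"
proof -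
  obtain J where J: "Y \<subseteq> F" "J \<in> \<I>" "transversal (F - Y) J" using Y by (rule tree_indepE)
  obtain I0 where I0: "X \<subseteq> F" "I0 \<in> \<I>" "transversal (F - X) I0" using X by (rule tree_indepE)
  have finJ: "finite J" using finite_indep_set J(2) .
  have "\<exists>I. (I \<in> \<I> \<and> transversal (F - X) I) \<and>
      (\<forall>I'. I' \<in> \<I> \<and> transversal (F - X) I' \<longrightarrow> card (I' \<inter> J) \<le> card (I \<inter> J))"
    by (rule ex_has_greatest_nat[where k = I0 and b = "Suc (card J)"])
      (use I0 finJ in \<open>auto intro: card_mono simp: less_Suc_eq_le\<close>)
  then obtain I where I: "I \<in> \<I>" "transversal (F - X) I"
    and max: "\<And>I'. I' \<in> \<I> \<Longrightarrow> transversal (F - X) I' \<Longrightarrow> card (I' \<inter> J) \<le> card (I \<inter> J)"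
    by blast
  have "card I < card J"
    using card_transversal[OF I(2) I0(1)] card_transversal[OF J(3,1)] less by simp
  then obtain z where z: "z \<in> J" "z \<notin> I" "insert z I \<in> \<I>"
    using indep_augment[OF I(1) J(2)] by blast
  have zV: "z \<in> V" using J(2) z(1) indep_subset by blast
  then obtain u where u: "u \<in> I" "conn (F - X) z u" using I(2) by (auto simp: transversal_def)
  have uV: "u \<in> V" using I(1) u(1) indep_subset by blast
  have uniq: "i = u" if "i \<in> I" "conn (F - X) z i" for i
  proof -
    have "conn (F - X) i u" using that(2) u(2) conn_trans conn_sym by metis
    then show ?thesis using I(2) that(1) u(1) by (simp add: transversal_def)
  qed
  have "\<not> conn (F - Y) z u"
  proof
    assume c: "conn (F - Y) z u"
    \<comment> \<open>Two elements of \<open>J\<close> joined in \<open>F - Y\<close> coincide, but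
      \<open>u\<close> is in \<open>I\<close> and \<open>z\<close> is not.\<close>
    have uJ: "u \<notin> J" using c J(3) z(1,2) u(1) unfolding transversal_def by blast
    \<comment> \<open>\<open>z\<close> takes over from \<open>u\<close> as the representative of
      their common component of \<open>F - X\<close>.\<close>
    let ?I = "insert z (I - {u})"
    have "?I \<in> \<I>" by (rule indep_hereditary[OF z(3)]) blast
    moreover have "transversal (F - X) ?I"
      unfolding transversal_def
    proof (intro conjI ballI impI)
      show "?I \<subseteq> V" using zV indep_subset[OF I(1)] by blast
      show "\<exists>i\<in>?I. conn (F - X) a i" if a: "a \<in> V" for a
      proof -
        obtain i where i: "i \<in> I" "conn (F - X) a i" using I(2) a by (auto simp: transversal_def)
        show ?thesis
        proof (cases "i = u")
          case True
          then have "conn (F - X) a z" using i(2) u(2) conn_trans conn_sym by metis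
          then show ?thesis by blast
        next
          case False
          then show ?thesis using i by blast
        qed
      qed
      fix i j assume ij: "i \<in> ?I" "j \<in> ?I" "conn (F - X) i j"
      show "i = j"
      proof (cases "i = z \<or> j = z")
        case True
        then show ?thesis using uniq[of i] uniq[of j] ij conn_sym[OF ij(3)] by blast
      next
        case False
        then show ?thesis using I(2) ij by (simp add: transversal_def)
      qed
    qed
    ultimately have "card (?I \<inter> J) \<le> card (I \<inter> J)" by (rule max)
    moreover have "?I \<inter> J = insert z (I \<inter> J)" using z(1) uJ by blast
    ultimately show False using finJ z(2) by simp
  qed
  then obtain y where y: "y \<in> Y" "\<not> conn (F - {y}) z u"
    using conn_Diff_iff[OF J(1) zV uV] by blast
  have yX: "y \<notin> X" using y(2) u(2) conn_Diff_iff[OF I0(1) zV uV] by blast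
  have yF: "y \<in> F" using y(1) J(1) by blast
  have sub: "insert y X \<subseteq> F" using yF I0(1) by blast
  obtain s t where st: "y = {s, t}" using edgeE[OF yF] by metis
  have eq: "F - insert y X = F - X - {{s, t}}" using st by blast
  have stA: "{s, t} \<in> F - X" using st yF yX by blast
  have zs: "conn (F - X) z s"
    using conn_lost_edge[OF stA u(2)] y(2) conn_Diff_iff[OF sub zV uV] unfolding eq by blast
  \<comment> \<open>Deleting \<open>y\<close> splits only the component of \<open>z\<close> and
    \<open>u\<close>, with \<open>z\<close> on one side and \<open>u\<close> on the other. A vertex
    cut off from its representative therefore had \<open>u\<close> as representative and is on the
    side of \<open>z\<close>.\<close>
  have "insert y X \<in> tree_indep V \<I> F"
  proof (rule tree_indepI[OF sub z(3)])
    fix a assume a: "a \<in> V"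
    obtain i where i: "i \<in> I" "conn (F - X) a i" using I(2) a by (auto simp: transversal_def)
    show "\<exists>i\<in>insert z I. conn (F - insert y X) a i"
    proof (cases "conn (F - insert y X) a i")
      case True
      then show ?thesis using i by blast
    next
      case False
      then have "conn (F - X) a s" using conn_lost_edge[OF stA i(2)] unfolding eq by blast
      then have az: "conn (F - X) a z" using zs conn_trans conn_sym by metis
      then have iu: "i = u" using uniq i conn_trans conn_sym by metis
      have "\<not> conn (F - {y}) a u"
        using False iu i(2) conn_Diff_iff[OF sub a uV] conn_Diff_iff[OF I0(1) a uV] by blast
      moreover have "\<not> conn (F - {y}) u z" using y(2) conn_sym by metis
      ultimately have "conn (F - {y}) a z" using bridge_two_sides[OF yF a uV zV] by blast
      then have "conn (F - insert y X) a z"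
        using az conn_Diff_iff[OF sub a zV] conn_Diff_iff[OF I0(1) a zV] by blast
      then show ?thesis by blast
    qed
  qed
  then show ?thesis using y(1) yX by blast
qed

text \<open>\<open>h\<close> names the part of each vertex, an element of \<open>B\<close> naming
  its own part. The edges obtained have \<open>B\<close> as a transversal, and \<open>B\<close> is
  independent.\<close>

lemma exists_tree_indep_of_labelling:
  assumes "B \<in> \<I>" "r \<in> B" "\<And>b. b \<in> B \<Longrightarrow> h b = b"
  obtains \<epsilon> where "inj_on \<epsilon> (B - {r})" "\<epsilon> ` (B - {r}) \<in> tree_indep V \<I> F"
    "\<And>b. b \<in> B - {r} \<Longrightarrow> \<exists>s t. \<epsilon> b = {s, t} \<and> h s = b \<and> h t \<noteq> b"
proof -
  obtain \<epsilon> where \<epsilon>: "inj_on \<epsilon> (B - {r})" "\<epsilon> ` (B - {r}) \<subseteq> F"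
    "\<And>b. b \<in> B - {r} \<Longrightarrow> \<exists>s t. \<epsilon> b = {s, t} \<and> h s = b \<and> h t \<noteq> b"
    "transversal (F - \<epsilon> ` (B - {r})) B"
    using exists_separating_edges[OF indep_subset[OF assms(1)] assms(2), of h] assms(3) by metis
  have "\<epsilon> ` (B - {r}) \<in> tree_indep V \<I> F"
    using \<epsilon>(4) by (intro tree_indepI[OF \<epsilon>(2) assms(1)]) (simp add: transversal_def)
  then show thesis using that \<epsilon> by blast
qed

lemma card_image_basis:
  assumes "basis \<I> B" "r \<in> B" "inj_on \<epsilon> (B - {r})"
  shows "card (\<epsilon> ` (B - {r})) = matroid_rank \<I> - 1"
  using assms card_image[OF assms(3)] by (simp add: basis_iff_card)

lemma exists_tree_indep_card_rank:
  assumes "matroid_rank \<I> \<ge> 1"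
  shows "\<exists>Y\<in>tree_indep V \<I> F. card Y = matroid_rank \<I> - 1"
proof -
  obtain B where B: "basis \<I> B"
    using exists_indep_card_rank basis_iff_card by blast
  then have BI: "B \<in> \<I>" "B \<noteq> {}" using assms by (auto simp: basis_iff_card)
  then obtain r where r: "r \<in> B" by blast
  obtain \<epsilon> where "inj_on \<epsilon> (B - {r})" "\<epsilon> ` (B - {r}) \<in> tree_indep V \<I> F"
    using exists_tree_indep_of_labelling[OF BI(1) r, of "\<lambda>v. v"] by metis
  then show ?thesis using card_image_basis[OF B r] by blast
qed

text \<open>With nothing deleted there is one component, so an independent singleton is required;
  hence the assumption on the rank.\<close>

lemma empty_tree_indep:
  assumes "matroid_rank \<I> \<ge> 1"
  shows "{} \<in> tree_indep V \<I> F"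
  using exists_tree_indep_card_rank[OF assms] tree_indep_hereditary by blast

section \<open>The greedy algorithm\<close>

text \<open>Claiming minimality at every intermediate size makes the induction along the run work:
  the exchange property carries it from one size to the next.\<close>

lemma greedy_optimal:
  assumes "matroid_rank \<I> \<ge> 1" "(gh_step V \<I> F w\<^sub>H)\<^sup>*\<^sup>* {} C"
  shows "C \<in> tree_indep V \<I> F \<and> card C \<le> matroid_rank \<I> - 1 \<and>
    (\<forall>Y\<in>tree_indep V \<I> F. card Y = card C \<longrightarrow> sum w\<^sub>H C \<le> sum w\<^sub>H Y)"
  using assms(2)
proof (induction rule: rtranclp_induct)
  case base
  \<comment> \<open>\<open>card\<close> also vanishes on infinite sets; finiteness of
    \<open>F\<close> excludes these.\<close>
  have "Y = {}" if "Y \<in> tree_indep V \<I> F" "card Y = 0" for Y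
  proof -
    have "Y \<subseteq> F" using that(1) by (simp add: tree_indep_def)
    then have "finite Y" using finite_F finite_subset by blast
    then show ?thesis using that(2) by simp
  qed
  then have "sum w\<^sub>H Y = 0" if "Y \<in> tree_indep V \<I> F" "card Y = 0" for Y
    using that by (metis sum.empty)
  then show ?case using empty_tree_indep[OF assms(1)] by simp
next
  case (step C C')
  then obtain e where e: "e \<in> F - C" "insert e C \<in> tree_indep V \<I> F" "C' = insert e C"
    and min: "\<And>y. y \<in> F - C \<Longrightarrow> insert y C \<in> tree_indep V \<I> F \<Longrightarrow> w\<^sub>H e \<le> w\<^sub>H y"
    and less: "card C < matroid_rank \<I> - 1"
    by (auto simp: gh_step_def is_arg_min_def not_less)
  have fin: "finite Z" if "Z \<in> tree_indep V \<I> F" for Z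
    using that finite_F finite_subset by (auto simp: tree_indep_def)
  have C: "C \<in> tree_indep V \<I> F" using step.IH by blast
  have card': "card C' = Suc (card C)" using e fin[OF C] by simp
  have "sum w\<^sub>H C' \<le> sum w\<^sub>H Y" if Y: "Y \<in> tree_indep V \<I> F" "card Y = card C'" for Y
  proof -
    have "Y \<noteq> {}" using Y card' by auto
    then have "Max (w\<^sub>H ` Y) \<in> w\<^sub>H ` Y" using fin[OF Y(1)] by (intro Max_in) auto
    \<comment> \<open>A heaviest \<open>y\<close> is removed: any \<open>y'\<close> in
      \<open>Y\<close> by which \<open>C\<close> can be extended weighs at most as much as
      \<open>y\<close>, and the greedy choice \<open>e\<close> at most as much as
      \<open>y'\<close>.\<close>
    then obtain y where y: "y \<in> Y" "w\<^sub>H y = Max (w\<^sub>H ` Y)" by auto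
    have "card (Y - {y}) = card C" using Y card' y fin[OF Y(1)] by simp
    moreover have "Y - {y} \<in> tree_indep V \<I> F" using tree_indep_hereditary[OF Y(1)] by blast
    ultimately have "sum w\<^sub>H C \<le> sum w\<^sub>H (Y - {y})" using step.IH by blast
    moreover have "w\<^sub>H e \<le> w\<^sub>H y"
    proof -
      obtain y' where y': "y' \<in> Y - C" "insert y' C \<in> tree_indep V \<I> F"
        using tree_indep_augment[OF C Y(1)] Y(2) card' by auto
      then have "y' \<in> F - C" by (auto simp: tree_indep_def)
      then have "w\<^sub>H e \<le> w\<^sub>H y'" using min y'(2) by blast
      also have "\<dots> \<le> w\<^sub>H y" using y' y(2) fin[OF Y(1)] by simp
      finally show ?thesis .
    qed
    moreover have "sum w\<^sub>H Y = w\<^sub>H y + sum w\<^sub>H (Y - {y})"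
      using y fin[OF Y(1)] by (simp add: sum.remove)
    moreover have "sum w\<^sub>H C' = w\<^sub>H e + sum w\<^sub>H C" using e fin[OF C] by simp
    ultimately show ?thesis by linarith
  qed
  then show ?case using e(2,3) card' less by auto
qed

text \<open>A smaller \<open>C\<close> could be augmented from a member of size
  \<open>matroid_rank \<I> - 1\<close>, and a lightest of the finitely many admissible edges would
  give a further step.\<close>

lemma greedy_complete:
  assumes "matroid_rank \<I> \<ge> 1" "(gh_step V \<I> F w\<^sub>H)\<^sup>*\<^sup>* {} C" "\<not> (\<exists>C'. gh_step V \<I> F w\<^sub>H C C')"
  shows "card C = matroid_rank \<I> - 1"
proof (rule ccontr)
  assume "card C \<noteq> matroid_rank \<I> - 1"
  then have less: "card C < matroid_rank \<I> - 1" and C: "C \<in> tree_indep V \<I> F"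
    using greedy_optimal[OF assms(1,2)] by auto
  then obtain y where y: "y \<notin> C" "insert y C \<in> tree_indep V \<I> F"
    using exists_tree_indep_card_rank[OF assms(1)] tree_indep_augment[OF C] by fastforce
  let ?S = "{e. e \<in> F - C \<and> insert e C \<in> tree_indep V \<I> F}"
  have S: "finite ?S" "?S \<noteq> {}" using finite_F y by (auto simp: tree_indep_def)
  obtain e where "is_arg_min w\<^sub>H (\<lambda>e. e \<in> ?S) e"
    using ex_is_arg_min_if_finite[OF S, of w\<^sub>H] by blast
  then have "gh_step V \<I> F w\<^sub>H C (insert e C)"
    unfolding gh_step_def mem_Collect_eq using less by blast
  then show False using assms(3) by blast
qed

text \<open>An independent transversal has \<open>Suc (card C)\<close> elements, so it is a basis.
  Stating the size with \<open>Suc\<close> avoids truncated subtraction.\<close>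

lemma feasible_components:
  assumes "C \<in> tree_indep V \<I> F" "Suc (card C) = matroid_rank \<I>"
  shows "feasible V \<I> (components V (F - C))"
proof -
  obtain I where I: "C \<subseteq> F" "I \<in> \<I>" "transversal (F - C) I" using assms(1) by (rule tree_indepE)
  have "basis \<I> I" using card_transversal[OF I(3,1)] I(2) assms(2) by (simp add: basis_iff_card)
  then show ?thesis
    unfolding feasible_def
    using components_partition_on card_components_Diff[OF I(1)] assms(2)
      transversal_Int_component[OF I(3)] by metis
qed

end

section \<open>Coverage and cut costs of partitions\<close>

definition crossing :: "'a set set \<Rightarrow> 'a set set \<Rightarrow> 'a set set" where
  "crossing E P = {e \<in> E. \<not> (\<exists>X\<in>P. e \<subseteq> X)}"

lemma finite_graph_edges: "graph V E \<Longrightarrow> finite E"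
  unfolding graph_def by (meson Pow_iff finite_Pow_iff finite_subset subsetI)

text \<open>Each end of \<open>e\<close> lies in exactly one part, and \<open>e\<close> crosses if
  these two parts differ. Double counting with these numbers yields both cost formulas.\<close>

lemma edge_parts:
  assumes "graph V E" "partition_on V P" "e \<in> E"
  shows "card {X \<in> P. e \<inter> X \<noteq> {}} = (if e \<in> crossing E P then 2 else 1)"
    and "card {X \<in> P. card (e \<inter> X) = 1} = (if e \<in> crossing E P then 2 else 0)"
proof -
  have e2: "e \<subseteq> V" "card e = 2" using assms(1,3) by (auto simp: graph_def)
  then obtain u v where e: "e = {u, v}" "u \<noteq> v" by (auto simp: card_2_iff)
  obtain X Y where X: "X \<in> P" "u \<in> X" and Y: "Y \<in> P" "v \<in> Y"
    using e e2(1) partition_onD1[OF assms(2)] by blast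
  have X': "u \<in> Z \<longleftrightarrow> Z = X" if "Z \<in> P" for Z
    using partition_onD2[OF assms(2)] that X by (auto simp: disjoint_def)
  have Y': "v \<in> Z \<longleftrightarrow> Z = Y" if "Z \<in> P" for Z
    using partition_onD2[OF assms(2)] that Y by (auto simp: disjoint_def)
  have "e \<inter> Z \<noteq> {} \<longleftrightarrow> u \<in> Z \<or> v \<in> Z" for Z using e(1) by blast
  then have meet: "{Z \<in> P. e \<inter> Z \<noteq> {}} = {X, Y}" using X(1) Y(1) X' Y' by auto
  have cross: "e \<in> crossing E P \<longleftrightarrow> X \<noteq> Y"
    using assms(3) X(1) Y(1) X' Y' e(1) by (auto simp: crossing_def)
  show "card {Z \<in> P. e \<inter> Z \<noteq> {}} = (if e \<in> crossing E P then 2 else 1)"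
    unfolding meet using cross by simp
  have one: "card (e \<inter> Z) = 1 \<longleftrightarrow> (u \<in> Z) \<noteq> (v \<in> Z)" for Z
    using e by (cases "u \<in> Z"; cases "v \<in> Z") auto
  have "{Z \<in> P. card (e \<inter> Z) = 1} = (if X = Y then {} else {X, Y})"
    unfolding one using X(1) Y(1) X' Y' by auto
  then show "card {Z \<in> P. card (e \<inter> Z) = 1} = (if e \<in> crossing E P then 2 else 0)"
    using cross by simp
qed

lemma sum_crossing:
  fixes w :: "'a set \<Rightarrow> real"
  assumes "finite E"
  shows "sum w (crossing E P) = (\<Sum>e\<in>E. if e \<in> crossing E P then w e else 0)"
proof -
  have "crossing E P = {e \<in> E. e \<in> crossing E P}" by (auto simp: crossing_def)
  then show ?thesis using sum.inter_filter[OF assms, of w "\<lambda>e. e \<in> crossing E P"] by simp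
qed

lemma finite_partition_on: "finite V \<Longrightarrow> partition_on V P \<Longrightarrow> finite P"
  by (metis finite_UnionD partition_onD1)

lemma coverage_cost:
  assumes "graph V E" "partition_on V P"
  shows "partition_cost (coverage E w) P = sum w E + sum w (crossing E P)"
proof -
  have fin: "finite P" "finite E"
    using assms finite_graph_edges finite_partition_on by (auto simp: graph_def)
  have "partition_cost (coverage E w) P = (\<Sum>e\<in>E. \<Sum>X | X \<in> P \<and> e \<inter> X \<noteq> {}. w e)"
    unfolding partition_cost_def coverage_def by (rule sum.swap_restrict[OF fin])
  also have "\<dots> = (\<Sum>e\<in>E. w e + (if e \<in> crossing E P then w e else 0))"
    using edge_parts(1)[OF assms] by (intro sum.cong) simp_all
  also have "\<dots> = sum w E + sum w (crossing E P)"
    by (simp add: sum.distrib sum_crossing[OF fin(2)])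
  finally show ?thesis .
qed

lemma cut_cost:
  assumes "graph V E" "partition_on V P"
  shows "partition_cost (cut_fun E w) P = 2 * sum w (crossing E P)"
proof -
  have fin: "finite P" "finite E"
    using assms finite_graph_edges finite_partition_on by (auto simp: graph_def)
  have "partition_cost (cut_fun E w) P = (\<Sum>e\<in>E. \<Sum>X | X \<in> P \<and> card (e \<inter> X) = 1. w e)"
    unfolding partition_cost_def cut_fun_def by (rule sum.swap_restrict[OF fin])
  also have "\<dots> = (\<Sum>e\<in>E. 2 * (if e \<in> crossing E P then w e else 0))"
    using edge_parts(2)[OF assms] by (intro sum.cong) simp_all
  also have "\<dots> = 2 * sum w (crossing E P)"
    by (simp add: sum_distrib_left sum_crossing[OF fin(2)])
  finally show ?thesis .
qed

section \<open>Gomory--Hu trees\<close>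

text \<open>For adjacent vertices the edge itself is a path, hence its weight is the minimum value
  of a cut between them, and its deletion gives a minimizer.\<close>

lemma gomory_hu_edge:
  assumes gh: "gomory_hu_tree V g F w\<^sub>H" and e: "{s, t} \<in> F"
  shows "s \<in> S \<Longrightarrow> S \<subseteq> V - {t} \<Longrightarrow> w\<^sub>H {s, t} \<le> g S"
    and "g (component V (F - {{s, t}}) s) \<le> w\<^sub>H {s, t}"
proof -
  interpret tree_graph V F using gh by unfold_locales (simp add: gomory_hu_tree_def)
  have st: "s \<noteq> t" "s \<in> V" "t \<in> V" using edgeE[OF e] by (metis doubleton_eq_iff)+
  let ?S = "{S. s \<in> S \<and> S \<subseteq> V - {t}}"
  have "is_path V F s [s, t] t" using st e by (simp add: is_path_def)
  then have Min: "Min (w\<^sub>H ` path_edges [s, t]) = Min (g ` ?S)"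
    and arg: "\<And>e. is_arg_min w\<^sub>H (\<lambda>e. e \<in> path_edges [s, t]) e \<Longrightarrow>
      is_arg_min g (\<lambda>S. s \<in> S \<and> S \<subseteq> V - {t}) (component V (F - {e}) s)"
    using gh st unfolding gomory_hu_tree_def by blast+
  have w: "w\<^sub>H {s, t} = Min (g ` ?S)" using Min by simp
  have fin: "finite ?S" using finite_V by (auto intro: finite_subset[of _ "Pow V"])
  show "w\<^sub>H {s, t} \<le> g S" if "s \<in> S" "S \<subseteq> V - {t}"
    unfolding w using fin that by (intro Min_le) auto
  \<comment> \<open>The singleton shows that the family of cuts is nonempty, so its minimum is
    attained.\<close>
  have "{s} \<in> ?S" using st by auto
  then have "Min (g ` ?S) \<in> g ` ?S" using fin by (intro Min_in) auto
  then obtain S0 where S0: "s \<in> S0" "S0 \<subseteq> V - {t}" "w\<^sub>H {s, t} = g S0" using w by auto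
  have "is_arg_min w\<^sub>H (\<lambda>e. e \<in> path_edges [s, t]) {s, t}" by (simp add: is_arg_min_def)
  from arg[OF this] S0 show "g (component V (F - {{s, t}}) s) \<le> w\<^sub>H {s, t}"
    by (auto simp: is_arg_min_def not_less)
qed

text \<open>The ends of a crossing edge are separated by some single edge of \<open>C\<close>, so
  the cuts belonging to the edges of \<open>C\<close> cover all crossing edges, and each of these
  cuts costs at most the weight of its tree edge.\<close>

lemma crossing_components_le:
  assumes "graph V E" "\<forall>e\<in>E. w e \<ge> 0" "gomory_hu_tree V (cut_fun E w) F w\<^sub>H" "C \<subseteq> F"
  shows "sum w (crossing E (components V (F - C))) \<le> sum w\<^sub>H C"
proof -
  interpret tree_graph V F using assms(3) by unfold_locales (simp add: gomory_hu_tree_def)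
  let ?P = "components V (F - C)"
  have "\<forall>e\<in>C. \<exists>s. s \<in> V \<and> cut_fun E w (component V (F - {e}) s) \<le> w\<^sub>H e"
  proof
    fix e assume "e \<in> C"
    then have "e \<in> F" using assms(4) by blast
    then obtain s t where "e = {s, t}" "s \<in> V" using edgeE by metis
    then show "\<exists>s. s \<in> V \<and> cut_fun E w (component V (F - {e}) s) \<le> w\<^sub>H e"
      using gomory_hu_edge(2)[OF assms(3)] \<open>e \<in> F\<close> by blast
  qed
  \<comment> \<open>\<open>s e\<close> marks one of the two sides of \<open>e\<close>, and
    \<open>?S e\<close> is that side.\<close>
  then obtain s where s: "\<forall>e\<in>C. s e \<in> V \<and> cut_fun E w (component V (F - {e}) (s e)) \<le> w\<^sub>H e"
    using bchoice[of C "\<lambda>e s. s \<in> V \<and> cut_fun E w (component V (F - {e}) s) \<le> w\<^sub>H e"] by blast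
  let ?S = "\<lambda>e. component V (F - {e}) (s e)"
  have fin: "finite C" "finite E"
    using finite_subset[OF assms(4) finite_F] finite_graph_edges[OF assms(1)] by auto
  have cut: "\<exists>e\<in>C. card (f \<inter> ?S e) = 1" if f: "f \<in> crossing E ?P" for f
  proof -
    have "f \<in> E" using f by (simp add: crossing_def)
    then have "f \<subseteq> V" "card f = 2" using assms(1) by (auto simp: graph_def)
    then obtain u v where uv: "f = {u, v}" "u \<noteq> v" "u \<in> V" "v \<in> V" by (auto simp: card_2_iff)
    have "\<not> conn (F - C) u v"
    proof
      assume "conn (F - C) u v"
      then have "f \<subseteq> component V (F - C) u" using uv by (simp add: component_conn)
      then show False using f uv(3) by (auto simp: crossing_def components_def)
    qed
    then obtain e where e: "e \<in> C" "\<not> conn (F - {e}) u v"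
      using conn_Diff_iff[OF assms(4) uv(3,4)] by blast
    have sV: "s e \<in> V" and eF: "e \<in> F" using s e(1) assms(4) by auto
    have "\<not> (conn (F - {e}) (s e) u \<and> conn (F - {e}) (s e) v)"
      using e(2) conn_trans conn_sym by metis
    \<comment> \<open>As there are only two sides, \<open>s e\<close> shares one with
      \<open>u\<close> or with \<open>v\<close>.\<close>
    moreover have "conn (F - {e}) (s e) u \<or> conn (F - {e}) (s e) v"
      using bridge_two_sides[OF eF uv(3) sV uv(4)] e(2) conn_sym by metis
    ultimately have "(u \<in> ?S e) \<noteq> (v \<in> ?S e)" using uv by (auto simp: component_conn)
    then have "f \<inter> ?S e = {u} \<or> f \<inter> ?S e = {v}" using uv(1) by blast
    then have "card (f \<inter> ?S e) = 1" by auto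
    then show ?thesis using e(1) by blast
  qed
  have "sum w (crossing E ?P) = (\<Sum>f\<in>E. if f \<in> crossing E ?P then w f else 0)"
    by (rule sum_crossing[OF fin(2)])
  also have "\<dots> \<le> (\<Sum>f\<in>E. \<Sum>e | e \<in> C \<and> card (f \<inter> ?S e) = 1. w f)"
  proof (rule sum_mono)
    fix f assume "f \<in> E"
    then have w0: "w f \<ge> 0" using assms(2) by blast
    show "(if f \<in> crossing E ?P then w f else 0) \<le> (\<Sum>e | e \<in> C \<and> card (f \<inter> ?S e) = 1. w f)"
    proof (cases "f \<in> crossing E ?P")
      case True
      then obtain e where "e \<in> C" "card (f \<inter> ?S e) = 1" using cut by blast
      then have "(\<Sum>e\<in>{e}. w f) \<le> (\<Sum>e | e \<in> C \<and> card (f \<inter> ?S e) = 1. w f)"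
        using fin w0 by (intro sum_mono2) auto
      then show ?thesis using True by simp
    next
      case False
      then show ?thesis using w0 by (simp add: sum_nonneg)
    qed
  qed
  also have "\<dots> = (\<Sum>e\<in>C. cut_fun E w (?S e))"
    unfolding cut_fun_def by (rule sum.swap_restrict[OF fin, symmetric])
  also have "\<dots> \<le> sum w\<^sub>H C" using s by (intro sum_mono) blast
  finally show ?thesis .
qed

text \<open>Each vertex is labelled by the basis element in its part. The edge chosen for
  \<open>b\<close> leaves the part of \<open>b\<close>, which is thus a cut between its ends and
  bounds its weight; distinct basis elements have distinct parts, so these bounds sum to at most the
  cost of \<open>Q\<close>.\<close>

lemma (in tree_matroid) exists_cheap_tree_indep:
  assumes gh: "gomory_hu_tree V g F w\<^sub>H" and g0: "\<And>S. g S \<ge> 0"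
    and Q: "feasible V \<I> Q" and k: "matroid_rank \<I> \<ge> 1"
  shows "\<exists>Y\<in>tree_indep V \<I> F. card Y = matroid_rank \<I> - 1 \<and> sum w\<^sub>H Y \<le> partition_cost g Q"
proof -
  obtain B where B: "basis \<I> B" and B1: "\<And>X. X \<in> Q \<Longrightarrow> card (B \<inter> X) = 1"
    and part: "partition_on V Q"
    using Q by (auto simp: feasible_def)
  have BI: "B \<in> \<I>" and "B \<noteq> {}" using B k by (auto simp: basis_iff_card)
  then obtain r where r: "r \<in> B" by blast
  have BV: "B \<subseteq> V" using indep_subset[OF BI] .
  define pt where "pt v = (THE X. X \<in> Q \<and> v \<in> X)" for v
  have pt: "pt v = X" if "X \<in> Q" "v \<in> X" for v X
    unfolding pt_def using that partition_onD2[OF part]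
    by (intro the_equality) (auto simp: disjoint_def)
  have ptQ: "pt v \<in> Q \<and> v \<in> pt v" if v: "v \<in> V" for v
  proof -
    obtain X where "X \<in> Q" "v \<in> X" using v partition_onD1[OF part] by blast
    then show ?thesis using pt by simp
  qed
  define h where "h v = the_elem (B \<inter> pt v)" for v
  have hpt: "B \<inter> pt v = {h v}" if v: "v \<in> V" for v
  proof -
    have "card (B \<inter> pt v) = 1" using B1 ptQ[OF v] by blast
    then obtain x where "B \<inter> pt v = {x}" by (rule card_1_singletonE)
    then show ?thesis by (simp add: h_def)
  qed
  have hB: "h b = b" if b: "b \<in> B" for b
  proof -
    have "b \<in> V" using BV b by blast
    then have "b \<in> {h b}" using hpt[of b] ptQ[of b] b by blast
    then show ?thesis by simp
  qed
  have hV: "{v \<in> V. h v = b} = pt b" if b: "b \<in> B" for b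
  proof
    show "{v \<in> V. h v = b} \<subseteq> pt b"
    proof
      fix v assume "v \<in> {v \<in> V. h v = b}"
      then have "v \<in> V" "b \<in> pt v" using hpt[of v] by auto
      then show "v \<in> pt b" using pt[of "pt v" b] ptQ[of v] by simp
    qed
    show "pt b \<subseteq> {v \<in> V. h v = b}"
    proof
      fix v assume v: "v \<in> pt b"
      have bV: "b \<in> V" using b BV by blast
      then have "v \<in> V" using v ptQ partition_onD1[OF part] by blast
      moreover have "pt v = pt b" using pt ptQ[OF bV] v by blast
      ultimately show "v \<in> {v \<in> V. h v = b}" using hB[OF b] by (simp add: h_def)
    qed
  qed
  obtain \<epsilon> where inj: "inj_on \<epsilon> (B - {r})" and ind: "\<epsilon> ` (B - {r}) \<in> tree_indep V \<I> F"
    and \<epsilon>: "\<And>b. b \<in> B - {r} \<Longrightarrow> \<exists>s t. \<epsilon> b = {s, t} \<and> h s = b \<and> h t \<noteq> b"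
    using exists_tree_indep_of_labelling[OF BI r, of h] hB by blast
  have le: "w\<^sub>H (\<epsilon> b) \<le> g (pt b)" if b: "b \<in> B - {r}" for b
  proof -
    obtain s t where st: "\<epsilon> b = {s, t}" "h s = b" "h t \<noteq> b" using \<epsilon>[OF b] by blast
    have F: "{s, t} \<in> F" using ind b st(1) by (auto simp: tree_indep_def)
    have "s \<in> {v \<in> V. h v = b}" "{v \<in> V. h v = b} \<subseteq> V - {t}"
      using st edge_in_V[OF F] by auto
    moreover have "{v \<in> V. h v = b} = pt b" using hV b by blast
    ultimately show ?thesis using gomory_hu_edge(1)[OF gh F, of "pt b"] unfolding st(1) by blast
  qed
  have injpt: "inj_on pt B"
  proof (rule inj_onI)
    fix b c assume "b \<in> B" "c \<in> B" "pt b = pt c"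
    then show "b = c" using hB by (metis h_def)
  qed
  have finB: "finite B" using finite_indep_set[OF BI] .
  have "sum w\<^sub>H (\<epsilon> ` (B - {r})) = (\<Sum>b\<in>B - {r}. w\<^sub>H (\<epsilon> b))"
    using sum.reindex[OF inj] by simp
  also have "\<dots> \<le> (\<Sum>b\<in>B - {r}. g (pt b))" using le by (rule sum_mono)
  \<comment> \<open>The term of \<open>r\<close>, for which no edge was chosen, is added; it is
    nonnegative.\<close>
  also have "\<dots> \<le> (\<Sum>b\<in>B. g (pt b))" using finB g0 by (intro sum_mono2) auto
  also have "\<dots> = sum g (pt ` B)" using sum.reindex[OF injpt, of g] by simp
  also have "\<dots> \<le> sum g Q"
    using finite_partition_on[OF finite_V part] ptQ BV g0 by (intro sum_mono2) auto
  finally have "sum w\<^sub>H (\<epsilon> ` (B - {r})) \<le> partition_cost g Q" by (simp add: partition_cost_def)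
  then show ?thesis using ind card_image_basis[OF B r inj] by blast
qed

section \<open>Feasibility and the approximation guarantee\<close>

theorem theorem5:
  fixes V :: "'a set" and E :: "'a set set" and w :: "'a set \<Rightarrow> real"
    and \<I> :: "'a set set" and k :: nat and P :: "'a set set"
  assumes "graph V E"
    and "\<forall>e\<in>E. w e \<ge> 0"
    and "matroid V \<I>"
    and "matroid_rank \<I> = k"
    and "k \<ge> 1"
    and "gh_algorithm_returns V (cut_fun E w) \<I> P"
  shows "feasible V \<I> P \<and>
    partition_cost (coverage E w) P \<le> 4 / 3 * opt V \<I> (coverage E w)"
proof -
  obtain F w\<^sub>H C where gh: "gomory_hu_tree V (cut_fun E w) F w\<^sub>H"
    and run: "(gh_step V \<I> F w\<^sub>H)\<^sup>*\<^sup>* {} C" and stop: "\<not> (\<exists>C'. gh_step V \<I> F w\<^sub>H C C')"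
    and P: "P = components V (F - C)"
    using assms(6) by (auto simp: gh_algorithm_returns_def)
  interpret matroid V \<I> by (rule assms(3))
  interpret tree_matroid V F \<I> using gh by unfold_locales (simp add: gomory_hu_tree_def)
  have k: "matroid_rank \<I> \<ge> 1" using assms(4,5) by simp
  have C: "C \<in> tree_indep V \<I> F"
    and opt: "\<And>Y. Y \<in> tree_indep V \<I> F \<Longrightarrow> card Y = card C \<Longrightarrow> sum w\<^sub>H C \<le> sum w\<^sub>H Y"
    using greedy_optimal[OF k run] by auto
  have cardC: "card C = matroid_rank \<I> - 1" using greedy_complete[OF k run stop] .
  have feas: "feasible V \<I> P" unfolding P using feasible_components[OF C] cardC k by simp
  have part: "partition_on V P" using feas by (simp add: feasible_def)
  have finE: "finite E" using finite_graph_edges[OF assms(1)] .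
  have cut0: "cut_fun E w S \<ge> 0" for S
    unfolding cut_fun_def using assms(2) by (intro sum_nonneg) auto
  have bound: "partition_cost (coverage E w) P \<le> 4 / 3 * partition_cost (coverage E w) Q"
    if Q: "feasible V \<I> Q" for Q
  proof -
    have partQ: "partition_on V Q" using Q by (simp add: feasible_def)
    obtain Y where Y: "Y \<in> tree_indep V \<I> F" "card Y = matroid_rank \<I> - 1"
      "sum w\<^sub>H Y \<le> partition_cost (cut_fun E w) Q"
      using exists_cheap_tree_indep[OF gh cut0 Q k] by blast
    have "C \<subseteq> F" using C by (simp add: tree_indep_def)
    then have "sum w (crossing E P) \<le> sum w\<^sub>H C"
      unfolding P by (rule crossing_components_le[OF assms(1,2) gh])
    also have "\<dots> \<le> sum w\<^sub>H Y" using opt Y cardC by simp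
    also have "\<dots> \<le> 2 * sum w (crossing E Q)" using Y(3) cut_cost[OF assms(1) partQ] by simp
    finally have twice: "sum w (crossing E P) \<le> 2 * sum w (crossing E Q)" .
    have total: "sum w (crossing E P) \<le> sum w E"
      using finE assms(2) by (intro sum_mono2) (auto simp: crossing_def)
    show ?thesis
      unfolding coverage_cost[OF assms(1) part] coverage_cost[OF assms(1) partQ]
      using twice total by simp
  qed
  \<comment> \<open>\<open>V\<close> has finitely many partitions and \<open>P\<close> is a feasible
    one, so the optimum is attained by some feasible \<open>Q\<close>, to which \<open>bound\<close>
    applies.\<close>
  have "finite {Q. feasible V \<I> Q}"
    by (rule finite_subset[OF _ finitely_many_partition_on[OF finite_V]]) (auto simp: feasible_def)
  then have "opt V \<I> (coverage E w) \<in> partition_cost (coverage E w) ` {Q. feasible V \<I> Q}"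
    unfolding opt_def using feas by (intro Min_in) auto
  then show ?thesis using feas bound by auto
qed

end
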